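(* Let $t\ge s$ be fixed positive integers and let $c>0$ be fixed. For every $\delta>0$ there exists $n_0$ such that for every $n\ge n_0$ and every graph $G$ on $n$ vertices that contains no induced copy of the complete bipartite graph $K_{s,t}$ and satisfies $\alpha(G)\ge cn$, we have $h(G)\le \delta n$. (That is: for $n$-vertex induced $K_{s,t}$-free graphs $G$ with $\alpha(G)=\Omega(n)$, $h(G)=o(n)$.)
   Context: All graphs are finite and simple. An independent set of $G$ is a set of pairwise non-adjacent vertices; a maximum independent set is one of largest possible size, and $\alpha(G)$ denotes this size (the independence number). A hitting set of $G$ is a subset $T\subseteq V(G)$ with $T\cap I\neq\emptyset$ for every maximum independent set $I$ of $G$; $h(G)$ denotes the smallest size of a hitting set of $G$. A graph is induced $K_{s,t}$-free if no induced subgraph of it is isomorphic to the complete bipartite graph $K_{s,t}$. *)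

theory Defs
  imports Complex_Main "Graph_Theory.Digraph_Component" "Graph_Theory.Kuratowski"
begin

(* Finite simple graphs are represented by the locale predicate graph: symmetric digraphs that are
   finite, without loops and without parallel arcs.  Adjacency of u and v is dominates. *)

definition independent_set :: "('a, 'b) pre_digraph \<Rightarrow> 'a set \<Rightarrow> bool" where
  "independent_set G I \<longleftrightarrow> I \<subseteq> verts G \<and> (\<forall>u\<in>I. \<forall>v\<in>I. \<not> u \<rightarrow>\<^bsub>G\<^esub> v)"

(* The maximum exists whenever verts G is finite, since the empty set is independent. *)
definition independence_number :: "('a, 'b) pre_digraph \<Rightarrow> nat" where
  "independence_number G = Max (card ` {I. independent_set G I})"

definition maximum_independent_set :: "('a, 'b) pre_digraph \<Rightarrow> 'a set \<Rightarrow> bool" where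
  "maximum_independent_set G I \<longleftrightarrow> independent_set G I \<and> card I = independence_number G"

definition hitting_set :: "('a, 'b) pre_digraph \<Rightarrow> 'a set \<Rightarrow> bool" where
  "hitting_set G T \<longleftrightarrow> T \<subseteq> verts G \<and> (\<forall>I. maximum_independent_set G I \<longrightarrow> T \<inter> I \<noteq> {})"

(* A finite graph has a hitting set (for instance verts G) unless it has no vertices; for the
   graph without vertices the value is unspecified. *)
definition hitting_number :: "('a, 'b) pre_digraph \<Rightarrow> nat" where
  "hitting_number G = (LEAST k. \<exists>T. hitting_set G T \<and> card T = k)"

(* complete_bipartite_digraph s t H says that H is some copy of the complete bipartite graph with
   parts of sizes s and t, so no separate isomorphism is needed. *)
definition induced_complete_bipartite_free :: "nat \<Rightarrow> nat \<Rightarrow> ('a, 'b) pre_digraph \<Rightarrow> bool" where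
  "induced_complete_bipartite_free s t G \<longleftrightarrow>
     \<not> (\<exists>H. induced_subgraph H G \<and> complete_bipartite_digraph s t H)"

end

(* Fix a maximum independent set I and a large constant m, and let d(u) be the number of neighbours
   of u in I.  For each scale i < m call u light if d(u) < n / m^i.  The bands
   n / m^(i+1) <= d(u) < n / m^i are disjoint, so at some scale the band has at most n/m vertices,
   and then there are at most 2n^2 / m^(i+1) edges between I and the light vertices.  By averaging,
   some S in I of size q = s m^i has only O(n/m) light neighbours; let T consist of S and these.
   If a maximum independent set J avoided T, then S would have at least |S| = q neighbours in J
   (otherwise exchange them for S), all of them heavy.  But a double count in the bipartite graph
   between I and J, which has no K_{s,t}, allows fewer than q heavy vertices in J. *)
theory Submission
  imports Defs
begin

section \<open>Averaging and double counting\<close>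

text \<open>Discarding an element of largest value never raises the mean of \<open>f\<close>; repeat
  this until \<open>q\<close> elements remain. Clearing denominators keeps everything in the
  naturals.\<close>

lemma average_subset:
  fixes f :: "'a \<Rightarrow> nat"
  assumes "finite A" "q \<le> card A"
  shows "\<exists>S\<subseteq>A. card S = q \<and> card A * sum f S \<le> q * sum f A"
  using assms
proof (induction "card A - q" arbitrary: A)
  case 0
  then have "card A = q" by simp
  then show ?case by blast
next
  case (Suc k)
  then have ne: "A \<noteq> {}" by auto
  have "\<exists>x\<in>A. \<forall>y\<in>A. f y \<le> f x"
    using Max_in[of "f ` A"] Max_ge[of "f ` A"] Suc.prems(1) ne by fastforce
  then obtain x where x: "x \<in> A" "\<And>y. y \<in> A \<Longrightarrow> f y \<le> f x" by blast
  define B where "B = A - {x}"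
  have cA: "card A = Suc (card B)" and fB: "finite B"
    unfolding B_def using x Suc.prems(1) ne by (auto simp: card_gt_0_iff)
  have sA: "sum f A = f x + sum f B"
    unfolding B_def using x Suc.prems(1) by (simp add: sum.remove)
  have "sum f B \<le> card B * f x"
    using sum_bounded_above[of B f "f x"] x(2) by (simp add: B_def)
  then have le: "card A * sum f B \<le> card B * sum f A"
    unfolding cA sA by (simp add: algebra_simps)
  have "k = card B - q" "q \<le> card B" using Suc.hyps(2) cA by auto
  from Suc.hyps(1)[OF this(1) fB this(2)]
  obtain S where S: "S \<subseteq> B" "card S = q" "card B * sum f S \<le> q * sum f B" by blast
  have "card A * sum f S \<le> q * sum f A"
  proof (cases "card B = 0")
    case True
    then have "S = {}" using S(1) fB by auto
    then show ?thesis by simp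
  next
    case False
    \<comment> \<open>Both inequalities are chained after multiplying by \<open>card B\<close>,
      which is then cancelled; hence the separate case where it is zero.\<close>
    have "card B * (card A * sum f S) \<le> card A * (q * sum f B)"
      using mult_le_mono2[OF S(3), of "card A"] by (simp add: mult_ac)
    also have "\<dots> \<le> card B * (q * sum f A)"
      using mult_le_mono2[OF le, of q] by (simp add: mult_ac)
    finally show ?thesis using False by simp
  qed
  then show ?case using S B_def by blast
qed

text \<open>The bands for different \<open>i\<close> are disjoint, so \<open>m\<close> of them with
  more than \<open>card V / m\<close> elements each would not fit into \<open>V\<close>.\<close>

lemma sparse_band:
  fixes f :: "'a \<Rightarrow> nat"
  assumes "finite V" "0 < m"
  shows "\<exists>i<m. m * card {v\<in>V. f v * m ^ i < n \<and> n \<le> f v * m ^ Suc i} \<le> card V"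
proof (rule ccontr)
  define B where "B i = {v\<in>V. f v * m ^ i < n \<and> n \<le> f v * m ^ Suc i}" for i
  assume "\<not> ?thesis"
  then have big: "card V < m * card (B i)" if "i < m" for i
    using that unfolding B_def by (meson not_le)
  have disj: "B i \<inter> B j = {}" if "i < j" for i j
  proof -
    have "f v * m ^ Suc i \<le> f v * m ^ j" for v
      using that assms(2) by (intro mult_le_mono2 power_increasing) auto
    then have "v \<notin> B j" if "v \<in> B i" for v
      using that unfolding B_def mem_Collect_eq by (meson le_less_trans not_le)
    then show ?thesis by blast
  qed
  have "m * card V = (\<Sum>i<m. card V)" by simp
  also have "\<dots> < (\<Sum>i<m. m * card (B i))"
    using big assms(2) by (intro sum_strict_mono) auto
  also have "\<dots> = m * card (\<Union>i<m. B i)"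
  proof -
    have "B i \<inter> B j = {}" if "i \<noteq> j" for i j
      using disj[of i j] disj[of j i] that by (metis inf_commute nat_neq_iff)
    moreover have "finite (B i)" for i unfolding B_def using assms(1) by simp
    ultimately show ?thesis
      by (subst card_UN_disjoint) (auto simp: sum_distrib_left)
  qed
  also have "\<dots> \<le> m * card V"
    using assms(1) by (intro mult_le_mono2 card_mono) (auto simp: B_def)
  finally show False by simp
qed

lemma sum_card_swap:
  assumes "finite A" "finite B"
  shows "(\<Sum>a\<in>A. card {b\<in>B. P a b}) = (\<Sum>b\<in>B. card {a\<in>A. P a b})"
  using sum.swap_restrict[OF assms, of "\<lambda>_ _. 1 :: nat" P] by simp

text \<open>A count in the style of Kovari, Sos and Turan. With \<open>s * p\<close> vertices of
  degree at least \<open>n / p\<close>, \<open>D\<close> sends at least \<open>s * n\<close> edges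
  to \<open>I\<close>. Vertices of \<open>I\<close> with fewer than \<open>s\<close> neighbours in
  \<open>D\<close> absorb at most \<open>(s - 1) * n\<close> of them, so the remaining
  \<open>n\<close> edges must end in the few vertices with at least \<open>s\<close>
  neighbours.\<close>

lemma bipartite_free_heavy_bound:
  assumes fin: "finite I" "finite D" and D: "card D = s * p" and p: "0 < p" and s: "0 < s"
    and I: "card I \<le> n"
    and free: "\<And>A. A \<subseteq> D \<Longrightarrow> card A = s \<Longrightarrow> card {v\<in>I. \<forall>u\<in>A. E u v} \<le> t"
    and heavy: "\<And>u. u \<in> D \<Longrightarrow> n \<le> card {v\<in>I. E u v} * p"
  shows "n \<le> (s * p choose s) * t * (s * p)"
proof -
  let ?q = "s * p"
  define W where "W = {v\<in>I. s \<le> card {u\<in>D. E u v}}"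
  define C where "C = {A. A \<subseteq> D \<and> card A = s}"
  have finC: "finite C" unfolding C_def using fin by simp
  \<comment> \<open>Each vertex of \<open>W\<close> is a common neighbour of some
    \<open>s\<close>-subset of \<open>D\<close>, and \<open>free\<close> limits how many vertices
    share one such subset.\<close>
  have "W \<subseteq> (\<Union>A\<in>C. {v\<in>I. \<forall>u\<in>A. E u v})"
  proof
    fix v assume v: "v \<in> W"
    then obtain A where "A \<subseteq> {u\<in>D. E u v}" "card A = s"
      unfolding W_def using obtain_subset_with_card_n by (metis (no_types, lifting) mem_Collect_eq)
    then show "v \<in> (\<Union>A\<in>C. {v\<in>I. \<forall>u\<in>A. E u v})"
      using v unfolding C_def W_def by auto
  qed
  then have "card W \<le> card (\<Union>A\<in>C. {v\<in>I. \<forall>u\<in>A. E u v})"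
    using finC fin by (intro card_mono) auto
  also have "\<dots> \<le> (\<Sum>A\<in>C. card {v\<in>I. \<forall>u\<in>A. E u v})"
    by (rule card_UN_le[OF finC])
  also have "\<dots> \<le> card C * t"
    using sum_bounded_above[of C "\<lambda>A. card {v\<in>I. \<forall>u\<in>A. E u v}" t] free
    by (simp add: C_def)
  also have "card C = (?q choose s)"
    unfolding C_def using n_subsets[OF fin(2), of s] D by simp
  finally have W: "card W \<le> (?q choose s) * t" .
  have "(\<Sum>u\<in>D. card {v\<in>I. E u v}) = (\<Sum>v\<in>I. card {u\<in>D. E u v})"
    by (rule sum_card_swap[OF fin(2,1)])
  also have "\<dots> \<le> (\<Sum>v\<in>I. (s - 1) + (if v \<in> W then ?q else 0))"
  proof (rule sum_mono)
    fix v assume "v \<in> I"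
    moreover have "card {u\<in>D. E u v} \<le> ?q"
      unfolding D[symmetric] using fin by (intro card_mono) auto
    ultimately show "card {u\<in>D. E u v} \<le> (s - 1) + (if v \<in> W then ?q else 0)"
      by (auto simp: W_def)
  qed
  also have "\<dots> = card I * (s - 1) + card W * ?q"
  proof -
    have "I \<inter> W = W" by (auto simp: W_def)
    then show ?thesis using fin by (simp add: sum.distrib sum.If_cases)
  qed
  also have "\<dots> \<le> n * (s - 1) + (?q choose s) * t * ?q"
    using I W by (intro add_mono mult_le_mono) auto
  finally have le: "(\<Sum>u\<in>D. card {v\<in>I. E u v}) \<le> n * (s - 1) + (?q choose s) * t * ?q" .
  have "p * (s * n) = (\<Sum>u\<in>D. n)" by (simp add: D mult_ac)
  also have "\<dots> \<le> (\<Sum>u\<in>D. card {v\<in>I. E u v} * p)" by (rule sum_mono) (rule heavy)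
  also have "\<dots> = p * (\<Sum>u\<in>D. card {v\<in>I. E u v})" by (simp add: sum_distrib_left mult.commute)
  also have "\<dots> \<le> p * (n * (s - 1) + (?q choose s) * t * ?q)" using le by simp
  finally have "s * n \<le> n * (s - 1) + (?q choose s) * t * ?q" using p by simp
  moreover have "s * n = n * (s - 1) + n" using s by (cases s) auto
  ultimately show ?thesis by linarith
qed

text \<open>Below the band, \<open>m ^ Suc i * d u < n\<close>, which adds up to at most
  \<open>n * n\<close>. Inside it only \<open>m ^ Suc i * d u < m * n\<close> holds, but there are
  at most \<open>n / m\<close> such vertices, which gives \<open>n * n\<close> again.\<close>

lemma light_edges_bound:
  fixes d :: "'a \<Rightarrow> nat"
  assumes V: "finite V" "card V = n"
    and band: "m * card {u\<in>V. d u * m ^ i < n \<and> n \<le> d u * m ^ Suc i} \<le> n"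
  shows "m ^ Suc i * sum d {u\<in>V. d u * m ^ i < n} \<le> 2 * n * n"
proof -
  define L where "L = {u\<in>V. d u * m ^ i < n}"
  define B where "B = {u\<in>V. d u * m ^ i < n \<and> n \<le> d u * m ^ Suc i}"
  have fin: "finite L" and sub: "L \<subseteq> V" "B \<subseteq> L" unfolding L_def B_def using V by auto
  have "m ^ Suc i * sum d L = (\<Sum>u\<in>L. m ^ Suc i * d u)" by (simp add: sum_distrib_left)
  also have "\<dots> \<le> (\<Sum>u\<in>L. n + (if u \<in> B then m * n else 0))"
  proof (rule sum_mono)
    fix u assume u: "u \<in> L"
    show "m ^ Suc i * d u \<le> n + (if u \<in> B then m * n else 0)"
    proof (cases "u \<in> B")
      case True
      then have "m * (d u * m ^ i) \<le> m * n" by (intro mult_le_mono2) (auto simp: B_def)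
      also have "m * (d u * m ^ i) = m ^ Suc i * d u" by simp
      finally show ?thesis using True by (simp only: if_True trans_le_add2)
    next
      case False
      then show ?thesis using u by (auto simp: B_def L_def mult_ac)
    qed
  qed
  also have "\<dots> = card L * n + card B * (m * n)"
    using fin sub(2) by (simp add: sum.distrib sum.If_cases Int_absorb1)
  also have "\<dots> \<le> n * n + n * n"
  proof (rule add_mono)
    show "card L * n \<le> n * n" using card_mono[OF V(1) sub(1)] V(2) by simp
    show "card B * (m * n) \<le> n * n"
      using mult_le_mono1[OF band, of n] by (simp add: B_def mult_ac)
  qed
  finally show ?thesis by (simp add: L_def)
qed

section \<open>Independent sets and common neighbours\<close>

lemma card_le_independence_number:
  assumes "finite (verts G)" "independent_set G I"
  shows "card I \<le> independence_number G"
proof -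
  have "finite {I. independent_set G I}"
    by (rule finite_subset[of _ "Pow (verts G)"]) (use assms in \<open>auto simp: independent_set_def\<close>)
  then show ?thesis unfolding independence_number_def using assms by (intro Max_ge) auto
qed

lemma ex_maximum_independent_set:
  assumes "finite (verts G)"
  shows "\<exists>I. maximum_independent_set G I"
proof -
  have "finite {I. independent_set G I}"
    by (rule finite_subset[of _ "Pow (verts G)"]) (use assms in \<open>auto simp: independent_set_def\<close>)
  moreover have "independent_set G {}" by (simp add: independent_set_def)
  ultimately have "independence_number G \<in> card ` {I. independent_set G I}"
    unfolding independence_number_def by (intro Max_in) auto
  then show ?thesis unfolding maximum_independent_set_def by auto
qed

text \<open>Any \<open>t\<close> common neighbours of \<open>A\<close> in \<open>I\<close> form an
  independent set, so together with \<open>A\<close> they induce a complete bipartite graph.\<close>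

lemma card_common_neighbours:
  assumes "graph G" and free: "induced_complete_bipartite_free s t G"
    and A: "independent_set G A" "card A = s"
    and I: "independent_set G I"
  shows "card {v\<in>I. \<forall>u\<in>A. u \<rightarrow>\<^bsub>G\<^esub> v} \<le> t"
proof (rule ccontr)
  interpret graph G by fact
  assume "\<not> ?thesis"
  then have "t \<le> card {v\<in>I. \<forall>u\<in>A. u \<rightarrow>\<^bsub>G\<^esub> v}" by simp
  then obtain B where B: "B \<subseteq> {v\<in>I. \<forall>u\<in>A. u \<rightarrow>\<^bsub>G\<^esub> v}" "card B = t"
    by (rule obtain_subset_with_card_n)
  have ind: "independent_set G B" using I B(1) unfolding independent_set_def by blast
  \<comment> \<open>A vertex in both sets would be adjacent to itself.\<close>
  have disj: "A \<inter> B = {}"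
    using A(1) B(1) by (auto simp: independent_set_def)
  have sub: "A \<union> B \<subseteq> verts G" using A(1) ind by (auto simp: independent_set_def)
  have indu: "induced_subgraph (G \<restriction> (A \<union> B)) G" using sub by (rule induced_induce)
  have "graph (G \<restriction> (A \<union> B))"
    using digraph.graphI[OF digraphI_induced[OF indu]]
      induced_graph_imp_symmetric[OF sym_arcs indu] by blast
  moreover have "arcs_ends (G \<restriction> (A \<union> B)) = A \<times> B \<union> B \<times> A"
  proof -
    have "arcs_ends (G \<restriction> (A \<union> B)) = {(u, v). u \<rightarrow>\<^bsub>G\<^esub> v \<and> u \<in> A \<union> B \<and> v \<in> A \<union> B}"
      by (auto simp: arcs_ends_conv)
    also have "\<dots> = A \<times> B \<union> B \<times> A"
      using A(1) ind B(1) arcs_ends_symmetric[OF sym_arcs] unfolding independent_set_def by blast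
    finally show ?thesis .
  qed
  ultimately have "complete_bipartite_digraph s t (G \<restriction> (A \<union> B))"
    unfolding complete_bipartite_digraph_def using disj A(2) B(2) by auto
  then show False using free indu unfolding induced_complete_bipartite_free_def by blast
qed

section \<open>Construction of the hitting set\<close>

text \<open>Here \<open>l\<close> bounds the number of light neighbours added to \<open>S\<close>;
  it is O(\<open>n / m\<close>) once the independence number is linear in \<open>n\<close>. The
  scale \<open>i\<close> depends on \<open>G\<close>, so \<open>large\<close> covers every scale and
  \<open>s * m ^ m\<close> bounds \<open>card S\<close> for all of them.\<close>

lemma small_hitting_set:
  assumes G: "graph G" and free: "induced_complete_bipartite_free s t G"
    and s: "0 < s" and m: "0 < m" and n: "card (verts G) = n"
    and large: "\<And>i. i < m \<Longrightarrow> (s * m ^ i choose s) * t * (s * m ^ i) < n"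
    and indep: "s * m ^ m \<le> independence_number G"
  shows "\<exists>T l. hitting_set G T \<and> card T \<le> s * m ^ m + l
    \<and> m * independence_number G * l \<le> 2 * s * n * n"
proof -
  interpret graph G by fact
  obtain I where "maximum_independent_set G I"
    using ex_maximum_independent_set finite_verts by blast
  then have I: "independent_set G I" "card I = independence_number G"
    by (auto simp: maximum_independent_set_def)
  have IV: "I \<subseteq> verts G" using I by (simp add: independent_set_def)
  then have finI: "finite I" using finite_verts finite_subset by blast
  define d where "d u = card {v\<in>I. u \<rightarrow>\<^bsub>G\<^esub> v}" for u
  obtain i where i: "i < m"
    and band: "m * card {u\<in>verts G. d u * m ^ i < n \<and> n \<le> d u * m ^ Suc i} \<le> n"
    using sparse_band[OF finite_verts m, of d n] n by blast
  define L where "L = {u\<in>verts G. d u * m ^ i < n}"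
  define e where "e v = card {u\<in>L. u \<rightarrow>\<^bsub>G\<^esub> v}" for v
  let ?q = "s * m ^ i"
  have q: "?q \<le> s * m ^ m" using i m by (intro mult_le_mono2 power_increasing) auto
  then have "?q \<le> card I" using indep unfolding I(2) by (rule le_trans)
  from average_subset[OF finI this, of e] obtain S where
    S: "S \<subseteq> I" "card S = ?q" "card I * sum e S \<le> ?q * sum e I" by blast
  have finS: "finite S" and finL: "finite L" using S finI finite_subset by (auto simp: L_def)
  have "sum e I = sum d L"
    unfolding e_def d_def using sum_card_swap[OF finI finL] by simp
  then have edges: "m ^ Suc i * sum e I \<le> 2 * n * n"
    using light_edges_bound[OF finite_verts n band] by (simp add: L_def)
  \<comment> \<open>The factor \<open>m ^ i\<close> in the size of \<open>S\<close> cancels against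
    \<open>m ^ Suc i\<close>, so a gain of \<open>m\<close> remains whatever the scale.\<close>
  have "m ^ i * (m * card I * sum e S) = m ^ Suc i * (card I * sum e S)" by (simp add: mult_ac)
  also have "\<dots> \<le> m ^ Suc i * (?q * sum e I)" using S(3) by (rule mult_le_mono2)
  also have "\<dots> = ?q * (m ^ Suc i * sum e I)" by (simp add: mult_ac)
  also have "\<dots> \<le> ?q * (2 * n * n)" using edges by (rule mult_le_mono2)
  also have "\<dots> = m ^ i * (2 * s * n * n)" by (simp add: mult_ac)
  finally have bound: "m * card I * sum e S \<le> 2 * s * n * n" using m by simp
  define T where "T = S \<union> (\<Union>v\<in>S. {u\<in>L. u \<rightarrow>\<^bsub>G\<^esub> v})"
  have "card T \<le> card S + card (\<Union>v\<in>S. {u\<in>L. u \<rightarrow>\<^bsub>G\<^esub> v})" unfolding T_def by (rule card_Un_le)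
  also have "card (\<Union>v\<in>S. {u\<in>L. u \<rightarrow>\<^bsub>G\<^esub> v}) \<le> sum e S"
    unfolding e_def by (rule card_UN_le[OF finS])
  finally have cardT: "card T \<le> s * m ^ m + sum e S" using S(2) q by linarith
  have "T \<inter> J \<noteq> {}" if "maximum_independent_set G J" for J
  proof
    assume empty: "T \<inter> J = {}"
    have J: "independent_set G J" "card J = independence_number G"
      using that by (auto simp: maximum_independent_set_def)
    have JV: "J \<subseteq> verts G" using J by (simp add: independent_set_def)
    then have finJ: "finite J" using finite_verts finite_subset by blast
    define N where "N = {u\<in>J. \<exists>v\<in>S. u \<rightarrow>\<^bsub>G\<^esub> v}"
    \<comment> \<open>Exchange: no vertex of \<open>J - N\<close> has a neighbour in
      \<open>S\<close>. As \<open>S\<close> lies in \<open>T\<close> and so misses \<open>J\<close>,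
      maximality of \<open>J\<close> forces \<open>card S <= card N\<close>.\<close>
    have "independent_set G ((J - N) \<union> S)"
      using J(1) I(1) S(1) arcs_ends_symmetric[OF sym_arcs]
      unfolding independent_set_def N_def by blast
    then have "card ((J - N) \<union> S) \<le> card J"
      using card_le_independence_number[OF finite_verts] J(2) by metis
    moreover have "card ((J - N) \<union> S) = card (J - N) + card S"
      using finJ finS empty by (intro card_Un_disjoint) (auto simp: T_def)
    moreover have "card (J - N) + card N = card J"
      using finJ card_Diff_subset[of N J] card_mono[of J N] finite_subset[of N J]
      by (auto simp: N_def)
    ultimately have "?q \<le> card N" using S(2) by simp
    then obtain D where D: "D \<subseteq> N" "card D = ?q" by (rule obtain_subset_with_card_n)
    have DJ: "D \<subseteq> J" using D by (auto simp: N_def)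
    have "n \<le> (?q choose s) * t * ?q"
    proof (rule bipartite_free_heavy_bound[where E = "\<lambda>u v. u \<rightarrow>\<^bsub>G\<^esub> v"])
      show "finite I" "0 < s" by fact+
      show "finite D" using DJ finJ finite_subset by blast
      show "card D = ?q" by fact
      show "0 < m ^ i" using m by simp
      show "card I \<le> n" using card_mono[OF finite_verts IV] n by simp
      show "card {v\<in>I. \<forall>u\<in>A. u \<rightarrow>\<^bsub>G\<^esub> v} \<le> t" if "A \<subseteq> D" "card A = s" for A
      proof (rule card_common_neighbours[OF G free _ that(2) I(1)])
        show "independent_set G A"
          using J(1) that(1) DJ unfolding independent_set_def by blast
      qed
      \<comment> \<open>A light vertex of \<open>D\<close> would be a light neighbour of
        \<open>S\<close>, hence in \<open>T\<close>, although \<open>D\<close> lies in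
        \<open>J\<close>.\<close>
      show "n \<le> card {v\<in>I. u \<rightarrow>\<^bsub>G\<^esub> v} * m ^ i" if "u \<in> D" for u
      proof (rule ccontr)
        assume "\<not> ?thesis"
        then have "u \<in> L" using that DJ JV by (auto simp: L_def d_def)
        then have "u \<in> T \<inter> J" using that D by (auto simp: T_def N_def)
        then show False using empty by simp
      qed
    qed
    then show False using large[OF i] by simp
  qed
  moreover have "T \<subseteq> verts G" using S IV by (auto simp: T_def L_def)
  ultimately have "hitting_set G T" by (simp add: hitting_set_def)
  then show ?thesis using cardT bound I(2) by auto
qed

section \<open>Choice of the constants\<close>

theorem theorem1:
  fixes s t :: nat and c :: real
  assumes "1 \<le> s" and "s \<le> t" and "c > 0"
  shows "\<forall>\<delta>::real. \<delta> > 0 \<longrightarrow>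
    (\<exists>n0::nat. \<forall>n\<ge>n0. \<forall>G :: ('a, 'b) pre_digraph.
      graph G \<and> card (verts G) = n \<and> induced_complete_bipartite_free s t G \<and>
      real (independence_number G) \<ge> c * real n
      \<longrightarrow> real (hitting_number G) \<le> \<delta> * real n)"
proof (intro allI impI)
  fix \<delta> :: real assume \<delta>: "\<delta> > 0"
  \<comment> \<open>Chosen so that \<open>2 * s * n / (m * c) <= \<delta> * n / 2\<close>, the half
    of the budget meant for \<open>l\<close>.\<close>
  define m where "m = nat \<lceil>4 * s / (c * \<delta>)\<rceil> + 1"
  have m: "0 < m" "4 * s \<le> m * (c * \<delta>)"
  proof -
    have "4 * s / (c * \<delta>) \<le> m" unfolding m_def by linarith
    then show "4 * s \<le> m * (c * \<delta>)" using \<delta> assms(3) by (simp add: field_simps)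
  qed (simp add: m_def)
  define Q where "Q = s * m ^ m"
  \<comment> \<open>The sum dominates the bound at every scale, and the 1 makes this strict and
    \<open>n\<close> positive. The last two terms give \<open>Q <= \<delta> * n / 2\<close>, the
    other half of the budget, and \<open>Q <= c * n\<close>, so that \<open>S\<close> fits into a
    maximum independent set.\<close>
  define n0 where "n0 = 1 + (\<Sum>i<m. (s * m ^ i choose s) * t * (s * m ^ i))
    + nat \<lceil>2 * Q / \<delta>\<rceil> + nat \<lceil>Q / c\<rceil>"
  show "\<exists>n0::nat. \<forall>n\<ge>n0. \<forall>G :: ('a, 'b) pre_digraph.
      graph G \<and> card (verts G) = n \<and> induced_complete_bipartite_free s t G \<and>
      real (independence_number G) \<ge> c * real n
      \<longrightarrow> real (hitting_number G) \<le> \<delta> * real n"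
  proof (intro exI[of _ n0] allI impI, elim conjE)
    fix n and G :: "('a, 'b) pre_digraph"
    assume n: "n0 \<le> n" and G: "graph G" "card (verts G) = n"
      "induced_complete_bipartite_free s t G" and \<alpha>: "real (independence_number G) \<ge> c * real n"
    have npos: "0 < n" using n by (simp add: n0_def)
    have "2 * Q / \<delta> \<le> n" "Q / c \<le> n" using n unfolding n0_def by linarith+
    then have Q: "2 * Q \<le> \<delta> * n" "Q \<le> c * n" using \<delta> assms(3) by (auto simp: field_simps)
    have large: "(s * m ^ i choose s) * t * (s * m ^ i) < n" if "i < m" for i
    proof -
      have "(s * m ^ i choose s) * t * (s * m ^ i)
          \<le> (\<Sum>i<m. (s * m ^ i choose s) * t * (s * m ^ i))"
        by (rule member_le_sum) (use that in auto)
      then show ?thesis using n by (simp add: n0_def)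
    qed
    have indep: "s * m ^ m \<le> independence_number G"
      using Q(2) \<alpha> unfolding Q_def by linarith
    obtain T l where T: "hitting_set G T" "card T \<le> Q + l"
      and l: "m * independence_number G * l \<le> 2 * s * n * n"
      using small_hitting_set[OF G(1,3) _ m(1) G(2) large indep] assms(1) unfolding Q_def by auto
    have "m * (c * n) * l \<le> real m * real (independence_number G) * real l"
      using \<alpha> by (intro mult_right_mono mult_left_mono) auto
    also have "\<dots> = real (m * independence_number G * l)" by simp
    also have "\<dots> \<le> real (2 * s * n * n)" using l of_nat_le_iff by blast
    also have "\<dots> = (4 * real s) * (real n * real n) / 2" by simp
    also have "\<dots> \<le> (m * (c * \<delta>)) * (real n * real n) / 2"
      using m(2) by (intro divide_right_mono mult_right_mono) auto
    finally have "(m * c * n) * l \<le> (m * c * n) * (\<delta> * n / 2)" by (simp add: mult_ac)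
    then have "l \<le> \<delta> * n / 2" using m(1) assms(3) npos by (simp add: mult_le_cancel_left)
    then have "real (card T) \<le> \<delta> * n" using T(2) Q(1) by linarith
    moreover have "hitting_number G \<le> card T"
      unfolding hitting_number_def using T(1) by (intro Least_le) auto
    ultimately show "real (hitting_number G) \<le> \<delta> * real n" by linarith
  qed
qed

end
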